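(* Let $I\subset\mathbb{R}$ be an interval with $0\in I$. For a continuous function $H:I\to\mathbb{R}$ put $$F(s)=\int_0^s\sin\Big(2\int_0^tH(u)\,du\Big)dt,\qquad G(s)=\int_0^s\cos\Big(2\int_0^tH(u)\,du\Big)dt,$$ and for $\mathbf c=(c_1,c_2,c_3)\in\mathbb{R}^3$ put $$\gamma(s;H,\mathbf c)=\Big(\int_0^s\frac{F'(G+c_2)-G'(F-c_1)}{\sqrt{(F-c_1)^2+(G+c_2)^2}}\,dt+c_3\,,\;\sqrt{(F-c_1)^2+(G+c_2)^2}\,,\;0\Big).$$ (i) Let $\gamma(s)=(x(s),y(s),0)$, $s\in I$, with $y>0$ and $x'^2+y'^2=1$, be the generating curve of a $C^2$ surface of revolution in $\mathbb{E}_1^3$ with spacelike axis $Ox$ and $C^0$ mean curvature $H(s)$. Then $\gamma(s)=\gamma(s;H,\mathbf c)$, where the constant vector $\mathbf c=(c_1,c_2,c_3)$ satisfies the initial conditions at $s=0$ given by $\gamma(0)=(c_3,\sqrt{c_1^2+c_2^2},0)$ and $\gamma'(0)=(c_1^2+c_2^2)^{-1/2}(c_1,c_2,0)$. (ii) Conversely, given a continuous function $H(s)$, $s\in I$, and constants $(c_1,c_2,c_3)\in T\times\mathbb{R}$, where $$T=\bigcup_{s\in I}\{(X,Y):\ [X-F(s)]^2+[Y+G(s)]^2\neq0\},$$ the $C^2$ curve $\gamma(s;H(s),\mathbf c)$ generates a $C^2$ surface of revolution with $C^0$ mean curvature $H(s)$ when rotated around the (spacelike) $x$-axis.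
   Context: $\mathbb{E}_1^3$ is $\mathbb{R}^3$ with coordinates $(x,y,z)$ and the metric $\langle u,v\rangle=u_1v_1+u_2v_2-u_3v_3$; a vector $v$ is spacelike if $\langle v,v\rangle>0$ or $v=0$. Rotating a curve $\gamma(s)=(x(s),y(s),0)$, $y>0$, parametrized by arc length, around the (spacelike) $x$-axis gives the surface of revolution $$X_{II}(s,\theta)=(x(s),y(s)\cosh\theta,y(s)\sinh\theta),\quad\theta\in\mathbb{R},$$ which is timelike (its induced metric is Lorentzian), with unit normal chosen as $N=(y',-x'\cosh\theta,-x'\sinh\theta)$. For a non-lightlike parametrized surface $X(u,v)$ with unit normal $N$, put $\epsilon=\langle N,N\rangle\in\{-1,1\}$ ($\epsilon=-1$ for spacelike, $+1$ for timelike surfaces; here $\epsilon=+1$), $g_{11}=\langle X_u,X_u\rangle$, $g_{12}=\langle X_u,X_v\rangle$, $g_{22}=\langle X_v,X_v\rangle$, $h_{11}=\langle X_{uu},N\rangle$, $h_{12}=\langle X_{uv},N\rangle$, $h_{22}=\langle X_{vv},N\rangle$. The mean curvature is $$H=\frac{\epsilon}{2}\,\frac{g_{11}h_{22}-2g_{12}h_{12}+g_{22}h_{11}}{g_{11}g_{22}-g_{12}^2}.$$ For the surface $X_{II}$ the mean curvature depends only on $s$.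
   Formalization: In (ii), for c in T×R the curve may meet the axis (H=0, c=0 gives y=|s|), so the claim on all of I fails; it is proved on the nonempty, relatively open set of s in I where y(s)≠0, and on all of I if (c1,c2) lies in the intersection instead of the union. I is not reduced to {0}. *)

theory Defs
  imports "HOL-Analysis.Analysis"
begin

definition lorentz :: "real^3 \<Rightarrow> real^3 \<Rightarrow> real" where
  "lorentz u v = u $ 1 * v $ 1 + u $ 2 * v $ 2 - u $ 3 * v $ 3"

text \<open>Class \<open>C\<^sup>2\<close> on a set that need not be open (an interval may contain its end points):
  Frechet derivatives are taken within the set.\<close>

definition C2_on :: "'a::real_normed_vector set \<Rightarrow> ('a \<Rightarrow> 'b::real_normed_vector) \<Rightarrow> bool" where
  "C2_on S f \<longleftrightarrow>
    (\<exists>(D :: 'a \<Rightarrow> 'a \<Rightarrow>\<^sub>L 'b) (D2 :: 'a \<Rightarrow> 'a \<Rightarrow>\<^sub>L 'a \<Rightarrow>\<^sub>L 'b).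
      (\<forall>p\<in>S. (f has_derivative blinfun_apply (D p)) (at p within S)) \<and>
      (\<forall>p\<in>S. (D has_derivative blinfun_apply (D2 p)) (at p within S)) \<and>
      continuous_on S D2)"

definition pderiv1 :: "real set \<Rightarrow> (real \<Rightarrow> real \<Rightarrow> real^3) \<Rightarrow> real \<Rightarrow> real \<Rightarrow> real^3" where
  "pderiv1 A X u v = vector_derivative (\<lambda>t. X t v) (at u within A)"

definition pderiv2 :: "real set \<Rightarrow> (real \<Rightarrow> real \<Rightarrow> real^3) \<Rightarrow> real \<Rightarrow> real \<Rightarrow> real^3" where
  "pderiv2 B X u v = vector_derivative (\<lambda>t. X u t) (at v within B)"

definition metric_det ::
  "real set \<Rightarrow> real set \<Rightarrow> (real \<Rightarrow> real \<Rightarrow> real^3) \<Rightarrow> real \<Rightarrow> real \<Rightarrow> real" where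
  "metric_det A B X u v =
    (let Xu = pderiv1 A X u v; Xv = pderiv2 B X u v
     in lorentz Xu Xu * lorentz Xv Xv - (lorentz Xu Xv)\<^sup>2)"

text \<open>Mean curvature of a surface \<open>X\<close>, parametrized over \<open>A \<times> B\<close>, with unit normal field \<open>N\<close>.\<close>

definition mean_curvature ::
  "real set \<Rightarrow> real set \<Rightarrow> (real \<Rightarrow> real \<Rightarrow> real^3) \<Rightarrow> (real \<Rightarrow> real \<Rightarrow> real^3)
    \<Rightarrow> real \<Rightarrow> real \<Rightarrow> real" where
  "mean_curvature A B X N u v =
    (let Xu = pderiv1 A X; Xv = pderiv2 B X;
         \<epsilon> = lorentz (N u v) (N u v);
         g11 = lorentz (Xu u v) (Xu u v);
         g12 = lorentz (Xu u v) (Xv u v);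
         g22 = lorentz (Xv u v) (Xv u v);
         h11 = lorentz (pderiv1 A Xu u v) (N u v);
         h12 = lorentz (pderiv2 B Xu u v) (N u v);
         h22 = lorentz (pderiv2 B Xv u v) (N u v)
     in \<epsilon> / 2 * ((g11 * h22 - 2 * g12 * h12 + g22 * h11) / metric_det A B X u v))"

text \<open>Rotation of a curve \<open>(x, y, 0)\<close> about the spacelike \<open>x\<close>-axis.\<close>

definition X_II :: "(real \<Rightarrow> real^3) \<Rightarrow> real \<Rightarrow> real \<Rightarrow> real^3" where
  "X_II \<gamma> s \<theta> = vector [\<gamma> s $ 1, \<gamma> s $ 2 * cosh \<theta>, \<gamma> s $ 2 * sinh \<theta>]"

definition N_II :: "real set \<Rightarrow> (real \<Rightarrow> real^3) \<Rightarrow> real \<Rightarrow> real \<Rightarrow> real^3" where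
  "N_II A \<gamma> s \<theta> =
    (let d = vector_derivative \<gamma> (at s within A)
     in vector [d $ 2, - (d $ 1) * cosh \<theta>, - (d $ 1) * sinh \<theta>])"

text \<open>The curve \<open>\<gamma>\<close>, with arc length parameter ranging over \<open>A\<close>, lies in the half plane
  \<open>z = 0\<close>, \<open>y > 0\<close> and sweeps out a \<open>C\<^sup>2\<close> timelike surface.\<close>

definition generates_C2_surface :: "real set \<Rightarrow> (real \<Rightarrow> real^3) \<Rightarrow> bool" where
  "generates_C2_surface A \<gamma> \<longleftrightarrow>
    (\<forall>s\<in>A. \<gamma> s $ 2 > 0 \<and> \<gamma> s $ 3 = 0) \<and>
    (\<forall>s\<in>A. (vector_derivative \<gamma> (at s within A) $ 1)\<^sup>2 +
           (vector_derivative \<gamma> (at s within A) $ 2)\<^sup>2 = 1) \<and>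
    C2_on (A \<times> UNIV) (\<lambda>(s, \<theta>). X_II \<gamma> s \<theta>) \<and>
    (\<forall>s\<in>A. \<forall>\<theta>. metric_det A UNIV (X_II \<gamma>) s \<theta> < 0)"

definition has_mean_curvature_II :: "real set \<Rightarrow> (real \<Rightarrow> real^3) \<Rightarrow> (real \<Rightarrow> real) \<Rightarrow> bool" where
  "has_mean_curvature_II A \<gamma> H \<longleftrightarrow>
    (\<forall>s\<in>A. \<forall>\<theta>. mean_curvature A UNIV (X_II \<gamma>) (N_II A \<gamma>) s \<theta> = H s)"

text \<open>The interval integrals below are oriented: for negative \<open>s\<close> they are minus the integral
  over \<open>(s, 0)\<close>. Only values of the integrand strictly between the two bounds matter.\<close>

definition F_int :: "(real \<Rightarrow> real) \<Rightarrow> real \<Rightarrow> real" where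
  "F_int H s = (LBINT t=0..ereal s. sin (2 * (LBINT u=0..ereal t. H u)))"

definition G_int :: "(real \<Rightarrow> real) \<Rightarrow> real \<Rightarrow> real" where
  "G_int H s = (LBINT t=0..ereal s. cos (2 * (LBINT u=0..ereal t. H u)))"

text \<open>If \<open>s\<close> is in the domain interval of \<open>H\<close>, every \<open>t\<close> strictly between \<open>0\<close> and \<open>s\<close> is interior
  to it, so the two-sided \<open>deriv\<close> is the derivative that is meant.\<close>

definition gamma_curve :: "(real \<Rightarrow> real) \<Rightarrow> real \<Rightarrow> real \<Rightarrow> real \<Rightarrow> real \<Rightarrow> real^3" where
  "gamma_curve H c1 c2 c3 s = vector
    [(LBINT t=0..ereal s.
        (deriv (F_int H) t * (G_int H t + c2) - deriv (G_int H) t * (F_int H t - c1)) /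
        sqrt ((F_int H t - c1)\<^sup>2 + (G_int H t + c2)\<^sup>2)) + c3,
     sqrt ((F_int H s - c1)\<^sup>2 + (G_int H s + c2)\<^sup>2),
     0]"

definition T_set :: "real set \<Rightarrow> (real \<Rightarrow> real) \<Rightarrow> (real \<times> real) set" where
  "T_set I H = (\<Union>s\<in>I. {(X, Y). (X - F_int H s)\<^sup>2 + (Y + G_int H s)\<^sup>2 \<noteq> 0})"

text \<open>Being a union, \<open>T_set\<close> only excludes that the profile \<open>gamma_curve\<close> lies entirely on the
  rotation axis. At a parameter where the profile meets the axis the rotated surface is not regular;
  the remaining parameters are the following ones.\<close>

definition regular_params :: "real set \<Rightarrow> (real \<Rightarrow> real) \<Rightarrow> real \<Rightarrow> real \<Rightarrow> real set" where
  "regular_params I H c1 c2 = {s\<in>I. (c1 - F_int H s)\<^sup>2 + (c2 + G_int H s)\<^sup>2 \<noteq> 0}"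

end

theory Submission
  imports Defs
begin

text \<open>For a unit speed profile with distance \<open>y\<close> to the axis, put \<open>P = y y'\<close> and \<open>Q = y x'\<close>. The
  prescribed mean curvature equation becomes the linear equation \<open>z' = 1 + 2 \<i> H z\<close> for
  \<open>z = P + \<i> Q\<close>. The integrating factor \<open>exp (- 2 \<i> \<integral> H)\<close> turns the solution into
  \<open>(G + c\<^sub>2) - \<i> (F - c\<^sub>1)\<close>, and the profile is recovered from \<open>y = \<bar>z\<bar>\<close> and \<open>x' = Im z / \<bar>z\<bar>\<close>.\<close>

section \<open>Calculus on intervals\<close>

text \<open>The mean curvature equation 2 H = x'/y + x'' y' - x' y'' is a single relation between
  two second derivatives. Differentiating x'^2 + y'^2 = 1 supplies the other one, and the weight y
  clears the quotient x'/y; this is why y y' and y x' obey a linear system. Conversely, where z does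
  not vanish, x' = Q/|z| and y' = |z|' = P/|z| have unit length automatically. The obstacle is that
  z may vanish at some parameters. The integral defining x starts at 0 and may run across such
  zeros, where its integrand is 0/0. The bound |Q| <= |z| settles integrability without analysing
  the quotient there, and differentiability is claimed only at regular parameters. Since I may
  contain end points, derivatives are taken within I throughout; they are unique because I has more
  than one point.\<close>

lemma interval_at_within_Icc:
  fixes I :: "real set"
  assumes "is_interval I" "c \<in> I" "s \<in> I"
  obtains a b where "c \<in> {a..b}" "s \<in> {a..b}" "{a..b} \<subseteq> I"
    "at s within I = at s within {a..b}"
proof -
  \<comment> \<open>Unless \<open>s\<close> is the left end of \<open>I\<close>, \<open>a\<close>
    lies strictly below \<open>s\<close>, so that \<open>{a..b}\<close> keeps all points of
    \<open>I\<close> near \<open>s\<close>. The choice of \<open>b\<close> is symmetric.\<close>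
  obtain a where a: "a \<in> I" "a \<le> s" "a \<le> c" "a < s \<or> (\<forall>u\<in>I. s \<le> u)"
  proof (cases "\<exists>u\<in>I. u < s")
    case True
    then obtain u where "u \<in> I" "u < s" by blast
    then show ?thesis using that[of "min u c"] assms by (auto simp: min_def)
  next
    case False
    then show ?thesis using that[of s] assms by force
  qed
  obtain b where b: "b \<in> I" "s \<le> b" "c \<le> b" "s < b \<or> (\<forall>u\<in>I. u \<le> s)"
  proof (cases "\<exists>u\<in>I. s < u")
    case True
    then obtain u where "u \<in> I" "s < u" by blast
    then show ?thesis using that[of "max u c"] assms by (auto simp: max_def)
  next
    case False
    then show ?thesis using that[of s] assms by force
  qed
  have sub: "{a..b} \<subseteq> I"
    using mem_is_interval_1_I[OF assms(1) a(1) b(1)] by auto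
  \<comment> \<open>On a side where \<open>s\<close> is an end point, nothing of \<open>I\<close>
    lies beyond \<open>s\<close>, so the distance 1 is arbitrary.\<close>
  define l where "l = (if a < s then a else s - 1)"
  define h where "h = (if s < b then b else s + 1)"
  have "at s within I = at s within {a..b}"
  proof (rule at_within_nhd)
    show "s \<in> {l<..<h}" by (simp add: l_def h_def)
    show "I \<inter> {l<..<h} - {s} = {a..b} \<inter> {l<..<h} - {s}"
      using sub a b by (force simp: l_def h_def split: if_splits)
  qed simp
  with sub a b show ?thesis by (intro that[of a b]) auto
qed

text \<open>Differentiability at \<open>s\<close> is local, so the fundamental theorem for compact
  intervals can be applied on a piece that contains \<open>c\<close> and a neighbourhood of
  \<open>s\<close> in \<open>I\<close>.\<close>

lemma interval_integral_has_real_derivative: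
  fixes f :: "real \<Rightarrow> real"
  assumes "is_interval I" "c \<in> I" "s \<in> I" "continuous_on I f"
  shows "((\<lambda>u. LBINT y=ereal c..ereal u. f y) has_real_derivative f s) (at s within I)"
proof -
  obtain a b where ab: "c \<in> {a..b}" "s \<in> {a..b}" "{a..b} \<subseteq> I"
    "at s within I = at s within {a..b}"
    using interval_at_within_Icc assms(1-3) by blast
  have "continuous_on {a..b} f" using assms(4) ab(3) continuous_on_subset by blast
  then show ?thesis
    using interval_integral_FTC2[of a c b f s] ab
    by (auto simp: has_real_derivative_iff_has_vector_derivative)
qed

text \<open>A connected set with more than one point has no isolated point. This is what makes
  derivatives within \<open>I\<close> unique.\<close>

lemma interval_at_within_neq_bot:
  fixes I :: "real set"
  assumes "is_interval I" "c \<in> I" "I \<noteq> {c}" "s \<in> I"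
  shows "at s within I \<noteq> bot"
proof -
  have "s islimpt I"
    using assms by (intro connected_imp_perfect) (auto simp: is_interval_connected)
  then show ?thesis by (simp add: trivial_limit_within)
qed

lemma interval_Ioo_subset:
  fixes I :: "real set"
  assumes "is_interval I" "a \<in> I" "b \<in> I"
  shows "{min a b<..<max a b} \<subseteq> I"
proof -
  have "min a b \<in> I" "max a b \<in> I"
    using assms by (auto simp: min_def max_def)
  from mem_is_interval_1_I[OF assms(1) this] show ?thesis by auto
qed

text \<open>Boundedness takes the place of continuity, for the integrand of x across points on the
  axis. Measurability is relative to the open interval because nothing is known about the integrand
  outside \<open>I\<close>.\<close>

lemma interval_integrable_bounded_measurable:
  fixes f :: "real \<Rightarrow> real"
  assumes "f \<in> borel_measurable (restrict_space borel {a<..<b})"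
    and "\<And>t. t \<in> {a<..<b} \<Longrightarrow> \<bar>f t\<bar> \<le> B" and "a \<le> b"
  shows "interval_lebesgue_integrable lborel (ereal a) (ereal b) f"
proof -
  have "set_integrable lborel {a<..<b} f"
  proof (rule set_integrable_bound)
    show "set_integrable lborel {a<..<b} (\<lambda>_. B)"
      using integrable_real_indicator[of "{a<..<b}" lborel] assms(3)
      by (simp add: set_integrable_def)
    show "set_borel_measurable lborel {a<..<b} f"
      using assms(1) borel_measurable_restrict_space_iff[of "{a<..<b}" borel f]
      by (simp add: set_borel_measurable_def)
    show "AE x in lborel. x \<in> {a<..<b} \<longrightarrow> norm (f x) \<le> norm B"
      using assms(2) by (intro AE_I2) force
  qed
  then show ?thesis using assms(3)
    by (simp add: interval_lebesgue_integrable_def)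
qed

section \<open>Second order differentiability of curves and surfaces\<close>

text \<open>Both partial derivatives enter as one argument \<open>w\<close>, which makes the map
  linear in \<open>w\<close>: differentiating the partials then differentiates the Frechet
  derivative.\<close>

definition pair_blinfun :: "'b \<times> 'b \<Rightarrow> (real \<times> real) \<Rightarrow>\<^sub>L ('b::real_normed_vector)" where
  "pair_blinfun w = (blinfun_scaleR_left (fst w) o\<^sub>L fst_blinfun)
    + (blinfun_scaleR_left (snd w) o\<^sub>L snd_blinfun)"

lemma pair_blinfun_apply [simp]: "blinfun_apply (pair_blinfun w) v = fst v *\<^sub>R fst w + snd v *\<^sub>R snd w"
  by (simp add: pair_blinfun_def blinfun.bilinear_simps)

lemma bounded_linear_pair_blinfun: "bounded_linear pair_blinfun"
proof -
  have comp: "bounded_linear (\<lambda>w. blinfun_scaleR_left (g w) o\<^sub>L L)"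
    if "bounded_linear g"
    for g :: "'a \<times> 'a \<Rightarrow> 'a" and L :: "(real \<times> real) \<Rightarrow>\<^sub>L real"
    by (rule bounded_linear_compose
        [OF bounded_bilinear.bounded_linear_left[OF bounded_bilinear_blinfun_compose]
            bounded_linear_compose[OF bounded_linear_blinfun_scaleR_left that]])
  show ?thesis
    unfolding pair_blinfun_def
    by (rule bounded_linear_add[OF comp[OF bounded_linear_fst] comp[OF bounded_linear_snd]])
qed

text \<open>The Frechet derivative is \<open>blinfun_scaleR_left\<close> applied to
  \<open>f1\<close>. Being bounded linear, that map commutes with differentiation, which yields the
  second derivative.\<close>

lemma C2_on_realI:
  fixes f :: "real \<Rightarrow> 'b::real_normed_vector"
  assumes "\<And>s. s \<in> S \<Longrightarrow> (f has_vector_derivative f1 s) (at s within S)"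
    and "\<And>s. s \<in> S \<Longrightarrow> (f1 has_vector_derivative f2 s) (at s within S)"
    and "continuous_on S f2"
  shows "C2_on S f"
  unfolding C2_on_def
proof (intro exI conjI ballI)
  let ?L = "blinfun_scaleR_left :: 'b \<Rightarrow> real \<Rightarrow>\<^sub>L 'b"
  let ?D2 = "\<lambda>s. Blinfun ?L o\<^sub>L ?L (f2 s)"
  have L: "bounded_linear ?L" by (rule bounded_linear_blinfun_scaleR_left)
  show "continuous_on S ?D2"
    by (intro continuous_intros bounded_linear.continuous_on[OF L] assms(3))
  fix s assume s: "s \<in> S"
  show "(f has_derivative blinfun_apply (?L (f1 s))) (at s within S)"
    using assms(1)[OF s] by (simp add: has_vector_derivative_def)
  have "((\<lambda>s. ?L (f1 s)) has_derivative (\<lambda>h. ?L (h *\<^sub>R f2 s))) (at s within S)"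
    using assms(2)[OF s] unfolding has_vector_derivative_def
    by (rule bounded_linear.has_derivative[OF L])
  then show "((\<lambda>s. ?L (f1 s)) has_derivative blinfun_apply (?D2 s)) (at s within S)"
    by (rule has_derivative_eq_rhs) (simp add: fun_eq_iff bounded_linear_Blinfun_apply[OF L])
qed

lemma C2_on_pairI:
  fixes f :: "real \<times> real \<Rightarrow> 'b::real_normed_vector"
  assumes "\<And>p. p \<in> S \<Longrightarrow> (f has_derivative pair_blinfun (f1 p, f2 p)) (at p within S)"
    and "\<And>p. p \<in> S \<Longrightarrow> (f1 has_derivative pair_blinfun (f11 p, f12 p)) (at p within S)"
    and "\<And>p. p \<in> S \<Longrightarrow> (f2 has_derivative pair_blinfun (f21 p, f22 p)) (at p within S)"
    and "continuous_on S f11" "continuous_on S f12" "continuous_on S f21" "continuous_on S f22"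
  shows "C2_on S f"
  unfolding C2_on_def
proof (intro exI conjI ballI)
  let ?L = "pair_blinfun :: 'b \<times> 'b \<Rightarrow> (real \<times> real) \<Rightarrow>\<^sub>L 'b"
  \<comment> \<open>The derivative of the pair \<open>(f1, f2)\<close>: its partial in the first
    variable is \<open>(f11, f21)\<close>, in the second \<open>(f12, f22)\<close>.\<close>
  let ?E = "\<lambda>p. pair_blinfun ((f11 p, f21 p), (f12 p, f22 p))"
  let ?D2 = "\<lambda>p. Blinfun ?L o\<^sub>L ?E p"
  have L: "bounded_linear ?L" by (rule bounded_linear_pair_blinfun)
  show "continuous_on S ?D2"
    by (intro continuous_intros bounded_linear.continuous_on[OF bounded_linear_pair_blinfun] assms(4-))
  fix p assume p: "p \<in> S"
  show "(f has_derivative blinfun_apply (?L (f1 p, f2 p))) (at p within S)"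
    using assms(1)[OF p] .
  have "((\<lambda>p. (f1 p, f2 p)) has_derivative blinfun_apply (?E p)) (at p within S)"
    using has_derivative_Pair[OF assms(2)[OF p] assms(3)[OF p]]
    by (rule has_derivative_eq_rhs) (auto simp: fun_eq_iff)
  then have "((\<lambda>p. ?L (f1 p, f2 p)) has_derivative (\<lambda>h. ?L (?E p h))) (at p within S)"
    by (rule bounded_linear.has_derivative[OF L])
  then show "((\<lambda>p. ?L (f1 p, f2 p)) has_derivative blinfun_apply (?D2 p)) (at p within S)"
    by (rule has_derivative_eq_rhs) (simp add: fun_eq_iff bounded_linear_Blinfun_apply[OF L])
qed

text \<open>A surface is assumed smooth only as a map of two variables; this recovers two
  derivatives of its profile by composing with the affine embedding of a slice.\<close>

lemma C2_on_Times_slice: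
  fixes f :: "real \<times> 'a::real_normed_vector \<Rightarrow> 'b::real_normed_vector"
  assumes "C2_on (A \<times> B) f" "b \<in> B"
  obtains f1 f2 where
    "\<And>s. s \<in> A \<Longrightarrow> ((\<lambda>s. f (s, b)) has_vector_derivative f1 s) (at s within A)"
    "\<And>s. s \<in> A \<Longrightarrow> (f1 has_vector_derivative f2 s) (at s within A)"
proof -
  obtain D D2 where
    D: "\<And>p. p \<in> A \<times> B \<Longrightarrow> (f has_derivative blinfun_apply (D p)) (at p within A \<times> B)" and
    D2: "\<And>p. p \<in> A \<times> B \<Longrightarrow> (D has_derivative blinfun_apply (D2 p)) (at p within A \<times> B)"
    using assms(1) unfolding C2_on_def by blast
  have slice: "((\<lambda>s. g (s, b)) has_derivative (\<lambda>h. g' (h, 0))) (at s within A)"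
    if "s \<in> A" "(g has_derivative g') (at (s, b) within A \<times> B)"
    for s and g :: "_ \<Rightarrow> 'c::real_normed_vector" and g'
  proof -
    have "((\<lambda>s. (s, b)) has_derivative (\<lambda>h. (h, 0))) (at s within A)"
      by (auto intro!: derivative_eq_intros)
    moreover have "(g has_derivative g') (at (s, b) within (\<lambda>s. (s, b)) ` A)"
      using that(2) assms(2) by (auto intro: has_derivative_subset)
    ultimately show ?thesis by (rule has_derivative_in_compose)
  qed
  have scale: "blinfun_apply L (h, 0) = h *\<^sub>R blinfun_apply L (1, 0)"
    for L :: "(real \<times> 'a) \<Rightarrow>\<^sub>L 'c::real_normed_vector" and h
    using blinfun.scaleR_right[of L h "(1, 0)"] by simp
  show ?thesis
  proof (rule that)
    fix s assume s: "s \<in> A"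
    show "((\<lambda>s. f (s, b)) has_vector_derivative D (s, b) (1, 0)) (at s within A)"
      using slice[OF s D] s assms(2)
      by (simp add: has_vector_derivative_def scale[symmetric])
    have "((\<lambda>s. D (s, b)) has_derivative (\<lambda>h. D2 (s, b) (h, 0))) (at s within A)"
      using slice[OF s D2] s assms(2) by simp
    then have "((\<lambda>s. D (s, b) (1, 0)) has_derivative (\<lambda>h. D2 (s, b) (h, 0) (1, 0))) (at s within A)"
      by (auto intro!: derivative_eq_intros)
    then show "((\<lambda>s. D (s, b) (1, 0)) has_vector_derivative D2 (s, b) (1, 0) (1, 0)) (at s within A)"
      unfolding has_vector_derivative_def
      by (rule has_derivative_eq_rhs) (intro ext, subst scale, rule blinfun.scaleR_left)
  qed
qed

section \<open>Geometry of the surface of revolution\<close>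

text \<open>As a linear combination of fixed vectors, the triple becomes accessible to the
  derivative and continuity rules.\<close>

lemma vector3_eq:
  "(vector [a, b, c] :: real^3) = a *\<^sub>R axis 1 1 + b *\<^sub>R axis 2 1 + c *\<^sub>R axis 3 1"
  by (simp add: vec_eq_iff forall_3 axis_def)

lemma has_derivative_vector3:
  assumes "(f has_derivative f') F" "(g has_derivative g') F" "(h has_derivative h') F"
  shows "((\<lambda>x. vector [f x, g x, h x] :: real^3) has_derivative (\<lambda>v. vector [f' v, g' v, h' v])) F"
  unfolding vector3_eq
  by (intro derivative_intros assms)

lemma has_vector_derivative_vector3:
  assumes "(f has_real_derivative f') F" "(g has_real_derivative g') F" "(h has_real_derivative h') F"
  shows "((\<lambda>x. vector [f x, g x, h x] :: real^3) has_vector_derivative vector [f', g', h']) F"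
proof -
  have "((\<lambda>x. vector [f x, g x, h x] :: real^3) has_derivative
      (\<lambda>v. vector [f' * v, g' * v, h' * v])) F"
    using assms unfolding has_field_derivative_def by (rule has_derivative_vector3)
  then show ?thesis
    unfolding has_vector_derivative_def
    by (rule has_derivative_eq_rhs) (simp add: fun_eq_iff vec_eq_iff forall_3 mult.commute)
qed

lemma continuous_on_vector3:
  assumes "continuous_on S f" "continuous_on S g" "continuous_on S h"
  shows "continuous_on S (\<lambda>x. vector [f x, g x, h x] :: real^3)"
  unfolding vector3_eq by (intro continuous_intros assms)

text \<open>The rotated surface and its partial derivatives all have this shape, with
  \<open>cosh\<close> and \<open>sinh\<close> exchanged by each angular derivative, so one rule
  serves for first and second order.\<close>

lemma has_derivative_rotated:
  assumes "(a has_real_derivative a') (at (fst p) within A)"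
    and "(b has_real_derivative b') (at (fst p) within A)"
    and "(g has_real_derivative g') (at (snd p))" "(k has_real_derivative k') (at (snd p))"
  shows "((\<lambda>p. vector [a (fst p), b (fst p) * g (snd p), b (fst p) * k (snd p)] :: real^3)
    has_derivative pair_blinfun
      (vector [a', b' * g (snd p), b' * k (snd p)],
       vector [0, b (fst p) * g', b (fst p) * k'])) (at p within A \<times> UNIV)"
proof -
  have fstd: "((\<lambda>p. f (fst p)) has_derivative (\<lambda>v. fst v * f')) (at p within A \<times> UNIV)"
    if "(f has_real_derivative f') (at (fst p) within A)" for f f'
  proof -
    have "(f has_derivative (\<lambda>h. h * f')) (at (fst p) within fst ` (A \<times> (UNIV :: real set)))"
      using that by (auto simp: has_field_derivative_def mult_commute_abs intro: has_derivative_subset)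
    from has_derivative_in_compose[OF has_derivative_fst[OF has_derivative_ident] this]
    show ?thesis .
  qed
  have sndd: "((\<lambda>p. f (snd p)) has_derivative (\<lambda>v. snd v * f')) (at p within A \<times> UNIV)"
    if "(f has_real_derivative f') (at (snd p))" for f f'
  proof -
    have "(f has_derivative (\<lambda>h. h * f')) (at (snd p))"
      using that by (simp add: has_field_derivative_def mult_commute_abs)
    from has_derivative_compose[OF has_derivative_snd[OF has_derivative_ident] this]
    show ?thesis .
  qed
  show ?thesis
    by (rule has_derivative_eq_rhs, rule has_derivative_vector3,
        rule fstd[OF assms(1)],
        rule has_derivative_mult[OF fstd[OF assms(2)] sndd[OF assms(3)]],
        rule has_derivative_mult[OF fstd[OF assms(2)] sndd[OF assms(4)]])
      (simp add: fun_eq_iff vec_eq_iff forall_3 algebra_simps)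
qed

lemma C2_on_X_II:
  assumes x1: "\<And>s. s \<in> A \<Longrightarrow> ((\<lambda>s. \<gamma> s $ 1) has_real_derivative x1 s) (at s within A)"
    and x2: "\<And>s. s \<in> A \<Longrightarrow> (x1 has_real_derivative x2 s) (at s within A)"
    and y1: "\<And>s. s \<in> A \<Longrightarrow> ((\<lambda>s. \<gamma> s $ 2) has_real_derivative y1 s) (at s within A)"
    and y2: "\<And>s. s \<in> A \<Longrightarrow> (y1 has_real_derivative y2 s) (at s within A)"
    and cont: "continuous_on A x2" "continuous_on A y2"
  shows "C2_on (A \<times> UNIV) (\<lambda>(s, \<theta>). X_II \<gamma> s \<theta>)"
proof -
  let ?y = "\<lambda>s. \<gamma> s $ 2"
  let ?W = "\<lambda>a b g k (p :: real \<times> real).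
    (vector [a (fst p), b (fst p) * g (snd p), b (fst p) * k (snd p)] :: real^3)"
  have ch: "(cosh has_real_derivative sinh t) (at t)"
    and sh: "(sinh has_real_derivative cosh t) (at t)" for t :: real
    by (auto intro!: derivative_eq_intros)
  have cony: "continuous_on A ?y" and cony1: "continuous_on A y1"
    using y1 y2 by (meson DERIV_continuous_on)+
  have contW: "continuous_on (A \<times> UNIV) (?W a b g k)"
    if "continuous_on A a" "continuous_on A b" "continuous_on UNIV g" "continuous_on UNIV k" for a b g k
    by (intro continuous_on_vector3 continuous_intros
        continuous_on_compose2[OF that(1)] continuous_on_compose2[OF that(2)]
        continuous_on_compose2[OF that(3)] continuous_on_compose2[OF that(4)]) auto
  have "C2_on (A \<times> UNIV) (?W (\<lambda>s. \<gamma> s $ 1) ?y cosh sinh)"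
  proof (rule C2_on_pairI)
    show "continuous_on (A \<times> UNIV) (?W x2 y2 cosh sinh)"
      by (rule contW) (intro cont continuous_intros)+
    show "continuous_on (A \<times> UNIV) (?W (\<lambda>_. 0) y1 sinh cosh)"
      by (rule contW) (intro cony1 continuous_intros)+
    \<comment> \<open>The two mixed partials are the same function, so this goal occurs
      twice.\<close>
    then show "continuous_on (A \<times> UNIV) (?W (\<lambda>_. 0) y1 sinh cosh)" .
    show "continuous_on (A \<times> UNIV) (?W (\<lambda>_. 0) ?y cosh sinh)"
      by (rule contW) (intro cony continuous_intros)+
  next
    fix p :: "real \<times> real" assume "p \<in> A \<times> UNIV"
    then have p: "fst p \<in> A" by auto
    show "(?W (\<lambda>s. \<gamma> s $ 1) ?y cosh sinh has_derivative
        pair_blinfun (?W x1 y1 cosh sinh p, ?W (\<lambda>_. 0) ?y sinh cosh p)) (at p within A \<times> UNIV)"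
      by (rule has_derivative_rotated[OF x1[OF p] y1[OF p] ch sh])
    show "(?W x1 y1 cosh sinh has_derivative
        pair_blinfun (?W x2 y2 cosh sinh p, ?W (\<lambda>_. 0) y1 sinh cosh p)) (at p within A \<times> UNIV)"
      by (rule has_derivative_rotated[OF x2[OF p] y2[OF p] ch sh])
    show "(?W (\<lambda>_. 0) ?y sinh cosh has_derivative
        pair_blinfun (?W (\<lambda>_. 0) y1 sinh cosh p, ?W (\<lambda>_. 0) ?y cosh sinh p)) (at p within A \<times> UNIV)"
      by (rule has_derivative_rotated[OF DERIV_const y1[OF p] sh ch])
  qed
  then show ?thesis by (simp add: X_II_def case_prod_unfold)
qed

text \<open>The form of \<open>X\<close> is asked for on \<open>A\<close> only, because the rule is
  used again on the first partial derivative, whose formula is available only there.\<close>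

lemma pderiv1_rotated:
  assumes "(a has_real_derivative a') (at s within A)" "(b has_real_derivative b') (at s within A)"
    and "at s within A \<noteq> bot" "s \<in> A"
    and "\<And>t. t \<in> A \<Longrightarrow> X t \<theta> = vector [a t, b t * g, b t * k]"
  shows "pderiv1 A X s \<theta> = vector [a', b' * g, b' * k]"
proof -
  have "((\<lambda>t. vector [a t, b t * g, b t * k] :: real^3) has_vector_derivative vector [a', b' * g, b' * k])
      (at s within A)"
    by (intro has_vector_derivative_vector3 DERIV_cmult_right assms)
  then have "((\<lambda>t. X t \<theta>) has_vector_derivative vector [a', b' * g, b' * k]) (at s within A)"
    using assms(4,5) by (rule has_vector_derivative_transform[rotated 2]) auto
  then show ?thesis
    unfolding pderiv1_def using assms(3) by (rule vector_derivative_within[rotated])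
qed

lemma pderiv2_rotated:
  assumes "(g has_real_derivative g') (at \<theta>)" "(k has_real_derivative k') (at \<theta>)"
    and "\<And>t. X s t = vector [a, b * g t, b * k t]"
  shows "pderiv2 UNIV X s \<theta> = vector [0, b * g', b * k']"
proof -
  have "((\<lambda>t. vector [a, b * g t, b * k t] :: real^3) has_vector_derivative vector [0, b * g', b * k'])
      (at \<theta>)"
    by (intro has_vector_derivative_vector3 DERIV_cmult DERIV_const assms)
  then show ?thesis
    unfolding pderiv2_def assms(3) by (rule vector_derivative_at)
qed

text \<open>In these coordinates the first fundamental form is diag(1, -y^2), the second is diag(x''
  y' - x' y'', -y x'), and the normal has square 1. The result is the mean of the two diagonal
  quotients.\<close>

lemma
  assumes x1: "\<And>s. s \<in> A \<Longrightarrow> ((\<lambda>s. \<gamma> s $ 1) has_real_derivative x1 s) (at s within A)"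
    and x2: "\<And>s. s \<in> A \<Longrightarrow> (x1 has_real_derivative x2 s) (at s within A)"
    and y1: "\<And>s. s \<in> A \<Longrightarrow> ((\<lambda>s. \<gamma> s $ 2) has_real_derivative y1 s) (at s within A)"
    and y2: "\<And>s. s \<in> A \<Longrightarrow> (y1 has_real_derivative y2 s) (at s within A)"
    and d: "\<And>s. s \<in> A \<Longrightarrow> vector_derivative \<gamma> (at s within A) = vector [x1 s, y1 s, 0]"
    and unit: "\<And>s. s \<in> A \<Longrightarrow> (x1 s)\<^sup>2 + (y1 s)\<^sup>2 = 1"
    and nb: "\<And>s. s \<in> A \<Longrightarrow> at s within A \<noteq> bot"
    and s: "s \<in> A" and y: "\<gamma> s $ 2 \<noteq> 0"
  shows metric_det_X_II: "metric_det A UNIV (X_II \<gamma>) s \<theta> = - (\<gamma> s $ 2)\<^sup>2"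
    and mean_curvature_X_II: "mean_curvature A UNIV (X_II \<gamma>) (N_II A \<gamma>) s \<theta> =
      (x1 s / \<gamma> s $ 2 + x2 s * y1 s - x1 s * y2 s) / 2"
proof -
  have ch: "(cosh has_real_derivative sinh t) (at t)"
    and sh: "(sinh has_real_derivative cosh t) (at t)" for t :: real
    by (auto intro!: derivative_eq_intros)
  let ?y = "\<lambda>s. \<gamma> s $ 2"
  have Xs: "pderiv1 A (X_II \<gamma>) u v = vector [x1 u, y1 u * cosh v, y1 u * sinh v]" if "u \<in> A" for u v
    by (rule pderiv1_rotated[OF x1[OF that] y1[OF that] nb[OF that] that]) (simp add: X_II_def)
  have Xt: "pderiv2 UNIV (X_II \<gamma>) u v = vector [0, ?y u * sinh v, ?y u * cosh v]" for u v
    by (rule pderiv2_rotated[OF ch sh]) (simp add: X_II_def)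
  have Xss: "pderiv1 A (pderiv1 A (X_II \<gamma>)) s \<theta> = vector [x2 s, y2 s * cosh \<theta>, y2 s * sinh \<theta>]"
    by (rule pderiv1_rotated[OF x2[OF s] y2[OF s] nb[OF s] s]) (simp add: Xs)
  have Xst: "pderiv2 UNIV (pderiv1 A (X_II \<gamma>)) s \<theta> = vector [0, y1 s * sinh \<theta>, y1 s * cosh \<theta>]"
    by (rule pderiv2_rotated[OF ch sh]) (simp add: Xs s)
  have Xtt: "pderiv2 UNIV (pderiv2 UNIV (X_II \<gamma>)) s \<theta> = vector [0, ?y s * cosh \<theta>, ?y s * sinh \<theta>]"
    by (rule pderiv2_rotated[OF sh ch]) (simp add: Xt)
  have N: "N_II A \<gamma> s \<theta> = vector [y1 s, - x1 s * cosh \<theta>, - x1 s * sinh \<theta>]"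
    by (simp add: N_II_def d s)
  have hyp: "cosh \<theta> * cosh \<theta> = 1 + sinh \<theta> * sinh \<theta>"
    using hyperbolic_pythagoras[of \<theta>] by (simp add: power2_eq_square)
  have u: "x1 s * x1 s + y1 s * y1 s = 1" using unit[OF s] by (simp add: power2_eq_square)
  \<comment> \<open>Rotation by \<open>\<theta>\<close> is a Lorentz isometry, so each product is
    the one at angle 0, between vectors of the form (a, b, 0) and (a, 0, b).\<close>
  have rot: "lorentz (vector [a, b * cosh \<theta>, b * sinh \<theta>]) (vector [a', b' * cosh \<theta>, b' * sinh \<theta>]) = a * a' + b * b'"
    "lorentz (vector [a, b * cosh \<theta>, b * sinh \<theta>]) (vector [a', b' * sinh \<theta>, b' * cosh \<theta>]) = a * a'"
    "lorentz (vector [a, b * sinh \<theta>, b * cosh \<theta>]) (vector [a', b' * cosh \<theta>, b' * sinh \<theta>]) = a * a'"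
    "lorentz (vector [a, b * sinh \<theta>, b * cosh \<theta>]) (vector [a', b' * sinh \<theta>, b' * cosh \<theta>]) = a * a' - b * b'"
    for a a' b b'
    using hyp by (simp_all add: lorentz_def) (algebra+)
  show md: "metric_det A UNIV (X_II \<gamma>) s \<theta> = - (\<gamma> s $ 2)\<^sup>2"
    by (simp add: metric_det_def Xs[OF s] Xt rot u power2_eq_square)
  show "mean_curvature A UNIV (X_II \<gamma>) (N_II A \<gamma>) s \<theta> =
      (x1 s / \<gamma> s $ 2 + x2 s * y1 s - x1 s * y2 s) / 2"
    unfolding mean_curvature_def Let_def md Xs[OF s] Xt Xss Xst Xtt N rot
    using u y by (simp add: divide_simps power2_eq_square) algebra
qed

section \<open>The explicit curve\<close>

context
  fixes I :: "real set" and H :: "real \<Rightarrow> real"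
  assumes I: "is_interval I" "0 \<in> I" "I \<noteq> {0}" and H: "continuous_on I H"
begin

definition angle :: "real \<Rightarrow> real" where
  "angle t = 2 * (LBINT u=0..ereal t. H u)"

lemma at_within_I: "s \<in> I \<Longrightarrow> at s within I \<noteq> bot"
  using interval_at_within_neq_bot[OF I] .

lemma has_real_derivative_integral_0:
  assumes "s \<in> I" "continuous_on I f"
  shows "((\<lambda>u. LBINT y=0..ereal u. f y) has_real_derivative f s) (at s within I)"
  using interval_integral_has_real_derivative[OF I(1,2) assms] by (simp add: zero_ereal_def)

lemma angle_deriv:
  "s \<in> I \<Longrightarrow> (angle has_real_derivative 2 * H s) (at s within I)"
  unfolding angle_def by (intro DERIV_cmult has_real_derivative_integral_0 H)

lemma continuous_on_angle: "continuous_on I angle"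
  using angle_deriv by (rule DERIV_continuous_on)

lemma F_int_deriv:
  "s \<in> I \<Longrightarrow> (F_int H has_real_derivative sin (angle s)) (at s within I)"
  unfolding F_int_def angle_def[symmetric]
  by (intro has_real_derivative_integral_0 continuous_intros continuous_on_angle)

lemma G_int_deriv:
  "s \<in> I \<Longrightarrow> (G_int H has_real_derivative cos (angle s)) (at s within I)"
  unfolding G_int_def angle_def[symmetric]
  by (intro has_real_derivative_integral_0 continuous_intros continuous_on_angle)

lemma continuous_on_F_int: "continuous_on I (F_int H)"
  using F_int_deriv by (rule DERIV_continuous_on)

lemma continuous_on_G_int: "continuous_on I (G_int H)"
  using G_int_deriv by (rule DERIV_continuous_on)

lemma F_int_0: "F_int H 0 = 0" and G_int_0: "G_int H 0 = 0" and angle_0: "angle 0 = 0"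
  by (simp_all add: F_int_def G_int_def angle_def zero_ereal_def[symmetric])

section \<open>The solution z and the curve for fixed constants c1, c2\<close>

context
  fixes c1 c2 :: real
begin

text \<open>\<open>Pfun\<close> and \<open>Qfun\<close> are the real and imaginary parts of exp(i
  angle) ((G + c2) - i (F - c1)). As F' = sin angle and G' = cos angle, \<open>Qfun\<close> is also
  the numerator in the integrand of x.\<close>

definition Pfun :: "real \<Rightarrow> real" where
  "Pfun t = cos (angle t) * (G_int H t + c2) + sin (angle t) * (F_int H t - c1)"

definition Qfun :: "real \<Rightarrow> real" where
  "Qfun t = sin (angle t) * (G_int H t + c2) - cos (angle t) * (F_int H t - c1)"

definition rfun :: "real \<Rightarrow> real" where
  "rfun t = sqrt ((F_int H t - c1)\<^sup>2 + (G_int H t + c2)\<^sup>2)"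

text \<open>Multiplication by exp(i angle) preserves the modulus.\<close>

lemma P_Q_squares: "(Pfun t)\<^sup>2 + (Qfun t)\<^sup>2 = (rfun t)\<^sup>2"
proof -
  have "(sin (angle t))\<^sup>2 + (cos (angle t))\<^sup>2 = 1" by simp
  moreover have "(rfun t)\<^sup>2 = (F_int H t - c1)\<^sup>2 + (G_int H t + c2)\<^sup>2"
    by (simp add: rfun_def)
  ultimately show ?thesis unfolding Pfun_def Qfun_def by algebra
qed

lemma rfun_nonneg: "0 \<le> rfun t"
  by (simp add: rfun_def)

text \<open>The inhomogeneous term 1 is exp(i angle) (G' - i F') = exp(i angle) exp(-i angle). It is
  real, hence present here and absent from the derivative of \<open>Qfun\<close>.\<close>

lemma Pfun_deriv:
  "s \<in> I \<Longrightarrow> (Pfun has_real_derivative 1 - 2 * H s * Qfun s) (at s within I)"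
  unfolding Pfun_def
  by (auto intro!: derivative_eq_intros angle_deriv F_int_deriv G_int_deriv)
    (simp add: Qfun_def algebra_simps flip: power2_eq_square)

lemma Qfun_deriv:
  "s \<in> I \<Longrightarrow> (Qfun has_real_derivative 2 * H s * Pfun s) (at s within I)"
  unfolding Qfun_def
  by (auto intro!: derivative_eq_intros angle_deriv F_int_deriv G_int_deriv)
    (simp add: Pfun_def algebra_simps)

lemma rfun_deriv:
  assumes "s \<in> I" "rfun s \<noteq> 0"
  shows "(rfun has_real_derivative Pfun s / rfun s) (at s within I)"
proof -
  let ?n = "\<lambda>t. (F_int H t - c1)\<^sup>2 + (G_int H t + c2)\<^sup>2"
  have n: "(?n has_real_derivative 2 * Pfun s) (at s within I)"
    using assms(1)
    by (auto intro!: derivative_eq_intros F_int_deriv G_int_deriv simp: Pfun_def algebra_simps)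
  have "0 < ?n s"
    using assms(2) by (simp add: rfun_def sum_power2_gt_zero_iff)
  then have "((\<lambda>t. sqrt (?n t)) has_real_derivative (inverse (sqrt (?n s)) / 2) * (2 * Pfun s)) (at s within I)"
    using DERIV_chain2[OF DERIV_real_sqrt n] by simp
  then show ?thesis
    unfolding rfun_def[symmetric] by (rule DERIV_cong) (simp add: field_simps)
qed

lemma abs_Q_div_r_le_1: "\<bar>Qfun t / rfun t\<bar> \<le> 1"
proof -
  have "(Qfun t)\<^sup>2 \<le> (rfun t)\<^sup>2"
    using P_Q_squares[of t] zero_le_power2[of "Pfun t"] by linarith
  then have "\<bar>Qfun t\<bar> \<le> rfun t"
    using rfun_nonneg[of t] by (metis abs_le_square_iff abs_of_nonneg)
  then show ?thesis
    \<comment> \<open>On the axis the quotient is 0 by the convention for division by zero.\<close>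
    using rfun_nonneg[of t] by (cases "rfun t = 0") (auto simp: abs_divide divide_le_eq_1)
qed

lemma gamma_curve_eq:
  assumes "s \<in> I"
  shows "gamma_curve H c1 c2 c3 s = vector [(LBINT t=0..ereal s. Qfun t / rfun t) + c3, rfun s, 0]"
proof -
  have "(LBINT t=0..ereal s.
        (deriv (F_int H) t * (G_int H t + c2) - deriv (G_int H) t * (F_int H t - c1)) /
        sqrt ((F_int H t - c1)\<^sup>2 + (G_int H t + c2)\<^sup>2)) = (LBINT t=0..ereal s. Qfun t / rfun t)"
  proof (rule interval_integral_cong)
    fix t assume "t \<in> einterval (min 0 (ereal s)) (max 0 (ereal s))"
    then have t: "t \<in> {min 0 s<..<max 0 s}"
      by (auto simp: einterval_def min_def max_def split: if_splits)
    have sub: "{min 0 s<..<max 0 s} \<subseteq> I"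
      \<comment> \<open>The open interval consists of interior points of \<open>I\<close>, where the
        derivative within \<open>I\<close> is two-sided and therefore determines
        \<open>deriv\<close>.\<close>
      using interval_Ioo_subset I assms by blast
    then have "t \<in> I" "at t within I = at t"
      using t at_within_open_subset[OF t open_greaterThanLessThan sub] by auto
    then have "deriv (F_int H) t = sin (angle t)" "deriv (G_int H) t = cos (angle t)"
      using F_int_deriv[of t] G_int_deriv[of t] by (auto intro: DERIV_imp_deriv)
    then show "(deriv (F_int H) t * (G_int H t + c2) - deriv (G_int H) t * (F_int H t - c1)) /
        sqrt ((F_int H t - c1)\<^sup>2 + (G_int H t + c2)\<^sup>2) = Qfun t / rfun t"
      by (simp add: Qfun_def rfun_def)
  qed
  then show ?thesis by (simp add: gamma_curve_def rfun_def)
qed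

lemma continuous_on_P: "continuous_on I Pfun"
  using Pfun_deriv by (rule DERIV_continuous_on)

lemma continuous_on_Q: "continuous_on I Qfun"
  using Qfun_deriv by (rule DERIV_continuous_on)

lemma continuous_on_r: "continuous_on I rfun"
  unfolding rfun_def by (intro continuous_intros continuous_on_F_int continuous_on_G_int)

text \<open>Between \<open>0\<close> and a regular parameter the curve may meet the axis, so the integrand need not be
  continuous there; it is only bounded.\<close>

lemma interval_integrable_Q_div_r:
  assumes "a \<in> I" "b \<in> I" "a \<le> b"
  shows "interval_lebesgue_integrable lborel (ereal a) (ereal b) (\<lambda>t. Qfun t / rfun t)"
proof (rule interval_integrable_bounded_measurable)
  have sub: "{a<..<b} \<subseteq> I" using interval_Ioo_subset[OF I(1) assms(1,2)] assms(3) by simp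
  show "(\<lambda>t. Qfun t / rfun t) \<in> borel_measurable (restrict_space borel {a<..<b})"
    by (intro borel_measurable_divide borel_measurable_continuous_on_restrict
        continuous_on_subset[OF _ sub] continuous_on_Q continuous_on_r)
qed (use assms abs_Q_div_r_le_1 in auto)

text \<open>Splitting the integral at \<open>s\<close> isolates the trouble: the part from 0 to
  \<open>s\<close> is a constant, and the part from \<open>s\<close> to \<open>u\<close> has a
  continuous integrand near \<open>s\<close>, since \<open>rfun\<close> stays nonzero there.\<close>

lemma integral_Q_div_r_deriv:
  assumes "s \<in> I" "rfun s \<noteq> 0"
  shows "((\<lambda>u. LBINT t=0..ereal u. Qfun t / rfun t) has_real_derivative Qfun s / rfun s) (at s within I)"
proof -
  let ?q = "\<lambda>t. Qfun t / rfun t"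
  have "openin (top_of_set I) (I \<inter> rfun -` (- {0}))"
    using continuous_on_r by (rule continuous_openin_preimage_gen) auto
  then obtain U where U: "open U" "I \<inter> rfun -` (- {0}) = I \<inter> U"
    by (auto simp: openin_open)
  moreover have "s \<in> U" using U assms by auto
  ultimately obtain e where e: "e > 0" "ball s e \<subseteq> U"
    by (meson open_contains_ball)
  let ?I' = "I \<inter> ball s e"
  have I': "is_interval ?I'" "s \<in> ?I'"
    using I assms e by (auto intro!: is_interval_Int is_interval_ball_real)
  have within: "at s within ?I' = at s within I"
    by (rule at_within_nhd[of s "ball s e"]) (use e in auto)
  have "continuous_on ?I' ?q"
    using U e
    by (intro continuous_on_divide continuous_on_subset[OF continuous_on_Q]
      continuous_on_subset[OF continuous_on_r]) auto
  from interval_integral_has_real_derivative[OF I'(1,2,2) this]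
  have "((\<lambda>u. (LBINT t=0..ereal s. ?q t) + (LBINT t=ereal s..ereal u. ?q t)) has_real_derivative ?q s)
      (at s within I)"
    unfolding within by (auto intro!: derivative_eq_intros)
  then show ?thesis
  proof (rule has_field_derivative_transform_within[OF _ zero_less_one assms(1)])
    fix u assume u: "u \<in> I"
    \<comment> \<open>Additivity over 0, \<open>s\<close>, \<open>u\<close> in any order needs
      integrability on their hull, which may contain zeros of \<open>rfun\<close>.\<close>
    have "interval_lebesgue_integrable lborel (min 0 (min (ereal s) (ereal u)))
        (max 0 (max (ereal s) (ereal u))) ?q"
    proof -
      have "min 0 (min s u) \<in> I" "max 0 (max s u) \<in> I"
        using I(2) assms(1) u by (auto simp: min_def max_def)
      then show ?thesis
        using interval_integrable_Q_div_r[of "min 0 (min s u)" "max 0 (max s u)"]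
        by (simp add: zero_ereal_def)
    qed
    then show "(LBINT t=0..ereal s. ?q t) + (LBINT t=ereal s..ereal u. ?q t) = (LBINT t=0..ereal u. ?q t)"
      by (rule interval_integral_sum)
  qed
qed

lemma regular_params_iff: "s \<in> regular_params I H c1 c2 \<longleftrightarrow> s \<in> I \<and> rfun s \<noteq> 0"
  by (auto simp: regular_params_def rfun_def power2_commute[of c1] add.commute[of c2])

text \<open>Relative openness makes derivatives within the regular parameters agree with those
  within \<open>I\<close>.\<close>

lemma openin_regular_params: "openin (top_of_set I) (regular_params I H c1 c2)"
proof -
  have "regular_params I H c1 c2 = I \<inter> rfun -` (- {0})"
    by (auto simp: regular_params_iff)
  then show ?thesis
    using continuous_openin_preimage_gen[OF continuous_on_r, of "- {0}"] by auto
qed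

lemma gamma_curve_surface:
  fixes c3 :: real
  defines "J \<equiv> regular_params I H c1 c2" and "\<gamma> \<equiv> gamma_curve H c1 c2 c3"
  shows "C2_on J \<gamma>" "generates_C2_surface J \<gamma>" "has_mean_curvature_II J \<gamma> H"
proof -
  have J: "s \<in> I" "rfun s \<noteq> 0" if "s \<in> J" for s
    using that by (auto simp: J_def regular_params_iff)
  have sub: "J \<subseteq> I" using J by auto
  have within: "at s within J = at s within I" if "s \<in> J" for s
  proof -
    obtain U where U: "open U" "J = I \<inter> U"
      using openin_regular_params unfolding J_def openin_open by blast
    show ?thesis
      by (rule at_within_nhd[of s U]) (use U that in auto)
  qed
  define x1 where "x1 = (\<lambda>s. Qfun s / rfun s)"
  define y1 where "y1 = (\<lambda>s. Pfun s / rfun s)"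
  \<comment> \<open>Quotient rule for Q/r and P/r, with r' = P/r and the linear system for P and
    Q.\<close>
  define x2 where "x2 = (\<lambda>s. 2 * H s * Pfun s / rfun s - Qfun s * Pfun s / rfun s ^ 3)"
  define y2 where "y2 = (\<lambda>s. (1 - 2 * H s * Qfun s) / rfun s - Pfun s * Pfun s / rfun s ^ 3)"
  have gam: "\<gamma> s = vector [(LBINT t=0..ereal s. Qfun t / rfun t) + c3, rfun s, 0]" if "s \<in> J" for s
    unfolding \<gamma>_def by (rule gamma_curve_eq[OF J(1)[OF that]])
  have dx: "((\<lambda>s. (LBINT t=0..ereal s. Qfun t / rfun t) + c3) has_real_derivative x1 s) (at s within J)"
    and dy: "(rfun has_real_derivative y1 s) (at s within J)" if "s \<in> J" for s
    using J[OF that] integral_Q_div_r_deriv[of s] rfun_deriv[of s]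
    unfolding x1_def y1_def within[OF that] by (auto intro!: derivative_eq_intros)
  have dx1: "((\<lambda>s. \<gamma> s $ 1) has_real_derivative x1 s) (at s within J)"
    and dy1: "((\<lambda>s. \<gamma> s $ 2) has_real_derivative y1 s) (at s within J)" if "s \<in> J" for s
    by (rule has_field_derivative_transform_within[OF dx[OF that] zero_less_one that]; simp add: gam)
      (rule has_field_derivative_transform_within[OF dy[OF that] zero_less_one that]; simp add: gam)
  have dx2: "(x1 has_real_derivative x2 s) (at s within J)"
    and dy2: "(y1 has_real_derivative y2 s) (at s within J)" if "s \<in> J" for s
  proof -
    have d: "(Qfun has_real_derivative 2 * H s * Pfun s) (at s within J)"
      "(Pfun has_real_derivative 1 - 2 * H s * Qfun s) (at s within J)"
      "(rfun has_real_derivative Pfun s / rfun s) (at s within J)"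
      using J[OF that] Qfun_deriv Pfun_deriv rfun_deriv unfolding within[OF that] by auto
    show "(x1 has_real_derivative x2 s) (at s within J)"
      unfolding x1_def
      by (rule DERIV_cong[OF DERIV_divide[OF d(1,3) J(2)[OF that]]])
        (use J(2)[OF that] in \<open>simp add: x2_def field_simps power3_eq_cube\<close>)
    show "(y1 has_real_derivative y2 s) (at s within J)"
      unfolding y1_def
      by (rule DERIV_cong[OF DERIV_divide[OF d(2,3) J(2)[OF that]]])
        (use J(2)[OF that] in \<open>simp add: y2_def field_simps power3_eq_cube\<close>)
  qed
  have cont: "continuous_on J x2" "continuous_on J y2"
    unfolding x2_def y2_def
    by (intro continuous_intros continuous_on_subset[OF continuous_on_P sub]
        continuous_on_subset[OF continuous_on_Q sub] continuous_on_subset[OF continuous_on_r sub]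
        continuous_on_subset[OF H sub]; use J in simp)+
  have dgam: "(\<gamma> has_vector_derivative vector [x1 s, y1 s, 0]) (at s within J)" if "s \<in> J" for s
    by (rule has_vector_derivative_transform[OF that gam])
      (auto intro!: has_vector_derivative_vector3 dx dy that)
  have dgam1: "((\<lambda>s. vector [x1 s, y1 s, 0] :: real^3) has_vector_derivative vector [x2 s, y2 s, 0])
      (at s within J)" if "s \<in> J" for s
    by (auto intro!: has_vector_derivative_vector3 dx2 dy2 that)
  show "C2_on J \<gamma>"
    by (rule C2_on_realI[OF dgam dgam1]) (auto intro!: continuous_on_vector3 cont)
  have nb: "at s within J \<noteq> bot" if "s \<in> J" for s
    using at_within_I J(1) that within by auto
  have vd: "vector_derivative \<gamma> (at s within J) = vector [x1 s, y1 s, 0]" if "s \<in> J" for s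
    using vector_derivative_within[OF nb dgam] that by blast
  have unit: "(x1 s)\<^sup>2 + (y1 s)\<^sup>2 = 1" if "s \<in> J" for s
    using P_Q_squares[of s] J(2)[OF that]
    by (simp add: x1_def y1_def power_divide add.commute flip: add_divide_distrib)
  have y: "\<gamma> s $ 2 = rfun s" "0 < rfun s" if "s \<in> J" for s
    using gam[OF that] J(2)[OF that] rfun_nonneg[of s] by auto
  have y0: "\<gamma> s $ 2 \<noteq> 0" if "s \<in> J" for s
    using y[OF that] by simp
  show "generates_C2_surface J \<gamma>"
    unfolding generates_C2_surface_def
  proof (intro conjI ballI allI)
    fix s \<theta> assume s: "s \<in> J"
    show "metric_det J UNIV (X_II \<gamma>) s \<theta> < 0"
      using metric_det_X_II[OF dx1 dx2 dy1 dy2 vd unit nb s y0[OF s]] y0[OF s] by simp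
  next
    show "C2_on (J \<times> UNIV) (\<lambda>(s, \<theta>). X_II \<gamma> s \<theta>)"
      by (rule C2_on_X_II[OF dx1 dx2 dy1 dy2 cont])
  qed (use y unit vd gam in auto)
  show "has_mean_curvature_II J \<gamma> H"
    unfolding has_mean_curvature_II_def
  proof (intro ballI allI)
    fix s \<theta> assume s: "s \<in> J"
    have r: "rfun s \<noteq> 0" by (rule J(2)[OF s])
    \<comment> \<open>The terms Q P^2 / r^4 cancel, and the -Q/r^2 coming from the profile's
      curvature cancels x'/y = Q/r^2. Only 2 H (P^2 + Q^2) / r^2 survives.\<close>
    have "x1 s / \<gamma> s $ 2 + x2 s * y1 s - x1 s * y2 s =
        (2 * H s * (rfun s)\<^sup>2 * ((Pfun s)\<^sup>2 + (Qfun s)\<^sup>2)) / rfun s ^ 4"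
      using r unfolding y(1)[OF s] x1_def x2_def y1_def y2_def
      by (simp add: field_simps power2_eq_square power3_eq_cube power4_eq_xxxx)
    also have "\<dots> = 2 * H s"
      using r unfolding P_Q_squares by (simp add: power2_eq_square power4_eq_xxxx)
    finally show "mean_curvature J UNIV (X_II \<gamma>) (N_II J \<gamma>) s \<theta> = H s"
      using mean_curvature_X_II[OF dx1 dx2 dy1 dy2 vd unit nb s y0[OF s]] by simp
  qed
qed

end

text \<open>The linear equation makes exp(-i angle) z - (G - i F) constant on \<open>I\<close>. Its
  value at 0 is z(0) = c2 + i c1, and undoing the rotation recovers z on all of
  \<open>I\<close>.\<close>

lemma surface_gamma_curve:
  assumes gen: "generates_C2_surface I \<gamma>" and mc: "has_mean_curvature_II I \<gamma> H"
  obtains c1 c2 c3 where "\<gamma> 0 = vector [c3, sqrt (c1\<^sup>2 + c2\<^sup>2), 0]"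
    "(\<gamma> has_vector_derivative (c1\<^sup>2 + c2\<^sup>2) powr (-1/2) *\<^sub>R vector [c1, c2, 0]) (at 0 within I)"
    "\<And>s. s \<in> I \<Longrightarrow> \<gamma> s = gamma_curve H c1 c2 c3 s"
proof -
  let ?y = "\<lambda>s. \<gamma> s $ 2"
  have pos: "0 < ?y s" and z0: "\<gamma> s $ 3 = 0" if "s \<in> I" for s
    using gen that by (auto simp: generates_C2_surface_def)
  have "C2_on (I \<times> UNIV) (\<lambda>(s, \<theta>). X_II \<gamma> s \<theta>)"
    using gen by (simp add: generates_C2_surface_def)
  \<comment> \<open>At angle 0 the surface is the profile itself, because its third coordinate
    vanishes.\<close>
  then obtain g1 g2 where
    g1: "\<And>s. s \<in> I \<Longrightarrow> ((\<lambda>s. X_II \<gamma> s 0) has_vector_derivative g1 s) (at s within I)" and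
    g2: "\<And>s. s \<in> I \<Longrightarrow> (g1 has_vector_derivative g2 s) (at s within I)"
    by (rule C2_on_Times_slice[of I UNIV _ 0]) auto
  have dgam: "(\<gamma> has_vector_derivative g1 s) (at s within I)" if "s \<in> I" for s
    by (rule has_vector_derivative_transform[OF that _ g1[OF that]])
      (simp add: X_II_def vec_eq_iff forall_3 z0)
  have comp: "((\<lambda>s. f s $ i) has_real_derivative f' $ i) F"
    if "(f has_vector_derivative f') F" for f :: "real \<Rightarrow> real^3" and f' F and i :: 3
    using bounded_linear.has_vector_derivative[OF bounded_linear_vec_nth that]
    by (simp add: has_real_derivative_iff_has_vector_derivative)
  define x1 where "x1 = (\<lambda>s. g1 s $ 1)"
  define y1 where "y1 = (\<lambda>s. g1 s $ 2)"
  define x2 where "x2 = (\<lambda>s. g2 s $ 1)"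
  define y2 where "y2 = (\<lambda>s. g2 s $ 2)"
  have dx1: "((\<lambda>s. \<gamma> s $ 1) has_real_derivative x1 s) (at s within I)"
    and dy1: "(?y has_real_derivative y1 s) (at s within I)"
    and dx2: "(x1 has_real_derivative x2 s) (at s within I)"
    and dy2: "(y1 has_real_derivative y2 s) (at s within I)" if "s \<in> I" for s
    unfolding x1_def y1_def x2_def y2_def by (rule comp dgam g2 that)+
  have "g1 s $ 3 = 0" if "s \<in> I" for s
  proof -
    have "((\<lambda>_. 0) has_real_derivative g1 s $ 3) (at s within I)"
      by (rule has_field_derivative_transform_within[OF comp[OF dgam[OF that]] zero_less_one that])
        (simp add: z0)
    then show ?thesis
      using at_within_I[OF that] DERIV_const has_field_derivative_unique by blast
  qed
  then have g1_eq: "g1 s = vector [x1 s, y1 s, 0]" if "s \<in> I" for s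
    using that by (simp add: vec_eq_iff forall_3 x1_def y1_def)
  have vd: "vector_derivative \<gamma> (at s within I) = vector [x1 s, y1 s, 0]" if "s \<in> I" for s
    using vector_derivative_within[OF at_within_I dgam] that by (auto simp: g1_eq)
  have unit: "(x1 s)\<^sup>2 + (y1 s)\<^sup>2 = 1" if "s \<in> I" for s
    using gen that by (simp add: generates_C2_surface_def vd)
  have curv: "2 * H s * ?y s = x1 s + ?y s * (x2 s * y1 s - x1 s * y2 s)" if "s \<in> I" for s
  proof -
    have "mean_curvature I UNIV (X_II \<gamma>) (N_II I \<gamma>) s 0 = H s"
      using mc that by (simp add: has_mean_curvature_II_def)
    moreover have "?y s \<noteq> 0" using pos[OF that] by simp
    ultimately show ?thesis
      using mean_curvature_X_II[OF dx1 dx2 dy1 dy2 vd unit at_within_I that, of 0]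
      by (simp add: field_simps)
  qed
  \<comment> \<open>The derivative of the constant squared speed, by uniqueness of derivatives
    within \<open>I\<close>.\<close>
  have orth: "x1 s * x2 s + y1 s * y2 s = 0" if "s \<in> I" for s
  proof -
    have "((\<lambda>s. (x1 s)\<^sup>2 + (y1 s)\<^sup>2) has_real_derivative 2 * (x1 s * x2 s + y1 s * y2 s)) (at s within I)"
      using that by (auto intro!: derivative_eq_intros dx2 dy2 simp: algebra_simps)
    then have "((\<lambda>_. 1) has_real_derivative 2 * (x1 s * x2 s + y1 s * y2 s)) (at s within I)"
      by (rule has_field_derivative_transform_within[OF _ zero_less_one that]) (simp add: unit)
    from has_field_derivative_unique[OF this DERIV_const at_within_I[OF that]] show ?thesis by simp
  qed
  \<comment> \<open>With k = x2 y1 - x1 y2, \<open>unit\<close> and \<open>orth\<close> give x2 = k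
    y1 and y2 = -k x1; then \<open>curv\<close> replaces x1 + y k by 2 H y.\<close>
  have P': "y1 s * y1 s + ?y s * y2 s = 1 - 2 * H s * (?y s * x1 s)"
    and Q': "y1 s * x1 s + ?y s * x2 s = 2 * H s * (?y s * y1 s)" if "s \<in> I" for s
    using curv[OF that] orth[OF that] unit[OF that] by algebra+
  define c1 where "c1 = ?y 0 * x1 0"
  define c2 where "c2 = ?y 0 * y1 0"
  define c3 where "c3 = \<gamma> 0 $ 1"
  \<comment> \<open>Real part of exp(-i angle) z - (G - i F); the imaginary part is treated the same
    way below.\<close>
  have "\<exists>c. \<forall>s\<in>I. cos (angle s) * (?y s * y1 s) + sin (angle s) * (?y s * x1 s) - G_int H s = c"
  proof (rule has_field_derivative_zero_constant)
    fix s assume s: "s \<in> I"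
    show "((\<lambda>s. cos (angle s) * (?y s * y1 s) + sin (angle s) * (?y s * x1 s) - G_int H s)
        has_real_derivative 0) (at s within I)"
      using P'[OF s] Q'[OF s] sin_cos_squared_add[of "angle s"]
      by (rule_tac derivative_eq_intros angle_deriv G_int_deriv dx2 dy2 dy1 s refl)+ algebra
  qed (use I is_interval_convex in auto)
  then obtain g where gc: "\<forall>s\<in>I. cos (angle s) * (?y s * y1 s) + sin (angle s) * (?y s * x1 s) - G_int H s = g"
    by blast
  have U: "cos (angle s) * (?y s * y1 s) + sin (angle s) * (?y s * x1 s) = G_int H s + c2"
    if "s \<in> I" for s
    using bspec[OF gc that] bspec[OF gc I(2)] by (simp add: angle_0 G_int_0 c2_def)
  have "\<exists>c. \<forall>s\<in>I. cos (angle s) * (?y s * x1 s) - sin (angle s) * (?y s * y1 s) + F_int H s = c"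
  proof (rule has_field_derivative_zero_constant)
    fix s assume s: "s \<in> I"
    show "((\<lambda>s. cos (angle s) * (?y s * x1 s) - sin (angle s) * (?y s * y1 s) + F_int H s)
        has_real_derivative 0) (at s within I)"
      using P'[OF s] Q'[OF s] sin_cos_squared_add[of "angle s"]
      by (rule_tac derivative_eq_intros angle_deriv F_int_deriv dx2 dy2 dy1 s refl)+ algebra
  qed (use I is_interval_convex in auto)
  then obtain f where fc: "\<forall>s\<in>I. cos (angle s) * (?y s * x1 s) - sin (angle s) * (?y s * y1 s) + F_int H s = f"
    by blast
  have V: "cos (angle s) * (?y s * x1 s) - sin (angle s) * (?y s * y1 s) = c1 - F_int H s"
    if "s \<in> I" for s
    using bspec[OF fc that] bspec[OF fc I(2)] by (simp add: angle_0 F_int_0 c1_def)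
  have r: "rfun c1 c2 s = ?y s" if "s \<in> I" for s
  proof -
    have "(F_int H s - c1)\<^sup>2 + (G_int H s + c2)\<^sup>2 = (?y s)\<^sup>2"
      using U[OF that] V[OF that] unit[OF that] sin_cos_squared_add[of "angle s"] by algebra
    then show ?thesis using pos[OF that] by (simp add: rfun_def)
  qed
  have Q: "Qfun c1 c2 s = ?y s * x1 s" if "s \<in> I" for s
    unfolding Qfun_def using U[OF that] V[OF that] sin_cos_squared_add[of "angle s"] by algebra
  have c_sq: "c1\<^sup>2 + c2\<^sup>2 = (?y 0)\<^sup>2"
    using unit[OF I(2)] unfolding c1_def c2_def by algebra
  show ?thesis
  proof
    show "\<gamma> 0 = vector [c3, sqrt (c1\<^sup>2 + c2\<^sup>2), 0]"
      using pos[OF I(2)] z0[OF I(2)] by (simp add: c_sq vec_eq_iff forall_3 c3_def)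
    \<comment> \<open>The modulus of z(0) is y(0), so this factor turns (c1, c2) = y(0) (x'(0),
      y'(0)) into the unit tangent.\<close>
    have "(c1\<^sup>2 + c2\<^sup>2) powr (-1/2) = 1 / ?y 0"
      using pos[OF I(2)]
      by (simp add: c_sq powr_minus_divide powr_half_sqrt)
    then have "(c1\<^sup>2 + c2\<^sup>2) powr (-1/2) *\<^sub>R vector [c1, c2, 0] = g1 0"
      using pos[OF I(2)] by (simp add: g1_eq I(2) vec_eq_iff forall_3 c1_def c2_def)
    then show "(\<gamma> has_vector_derivative (c1\<^sup>2 + c2\<^sup>2) powr (-1/2) *\<^sub>R vector [c1, c2, 0]) (at 0 within I)"
      using dgam[OF I(2)] by simp
    fix s assume s: "s \<in> I"
    \<comment> \<open>Here y is positive on all of \<open>I\<close>, so the integrand of x is the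
      continuous function x' and the classical fundamental theorem applies.\<close>
    have q: "Qfun c1 c2 t / rfun c1 c2 t = x1 t" if "t \<in> I" for t
      using pos[OF that] by (simp add: Q r that)
    have "min 0 s \<in> I" "max 0 s \<in> I"
      using I(2) s by (auto simp: min_def max_def)
    from mem_is_interval_1_I[OF I(1) this] have sub: "{min 0 s..max 0 s} \<subseteq> I"
      by auto
    have "(LBINT t=0..ereal s. Qfun c1 c2 t / rfun c1 c2 t) = (LBINT t=ereal 0..ereal s. x1 t)"
      unfolding zero_ereal_def
    proof (rule interval_integral_cong)
      fix t assume "t \<in> einterval (min (ereal 0) (ereal s)) (max (ereal 0) (ereal s))"
      then have "t \<in> {min 0 s..max 0 s}"
        by (auto simp: einterval_def min_def max_def split: if_splits)
      then show "Qfun c1 c2 t / rfun c1 c2 t = x1 t"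
        using sub q by blast
    qed
    also have "\<dots> = \<gamma> s $ 1 - \<gamma> 0 $ 1"
    proof (rule interval_integral_FTC_finite)
      have "continuous_on I x1" using dx2 by (rule DERIV_continuous_on)
      then show "continuous_on {min 0 s..max 0 s} x1" using sub continuous_on_subset by blast
      fix t assume "min 0 s \<le> t" "t \<le> max 0 s"
      then have "t \<in> I" using sub by auto
      then show "((\<lambda>s. \<gamma> s $ 1) has_vector_derivative x1 t) (at t within {min 0 s..max 0 s})"
        using dx1 sub
        by (auto simp: has_real_derivative_iff_has_vector_derivative intro: has_vector_derivative_within_subset)
    qed
    finally show "\<gamma> s = gamma_curve H c1 c2 c3 s"
      by (simp add: gamma_curve_eq s r vec_eq_iff forall_3 c3_def z0)
  qed
qed

end

theorem theorem2p4:
  fixes I :: "real set" and H :: "real \<Rightarrow> real"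
  assumes "is_interval I" and "0 \<in> I" and "I \<noteq> {0}"
    and "continuous_on I H"
  shows
    "(\<forall>\<gamma> :: real \<Rightarrow> real^3.
        generates_C2_surface I \<gamma> \<and> has_mean_curvature_II I \<gamma> H \<longrightarrow>
        (\<exists>c1 c2 c3.
           \<gamma> 0 = vector [c3, sqrt (c1\<^sup>2 + c2\<^sup>2), 0] \<and>
           (\<gamma> has_vector_derivative (c1\<^sup>2 + c2\<^sup>2) powr (-1/2) *\<^sub>R vector [c1, c2, 0]) (at 0 within I) \<and>
           (\<forall>s\<in>I. \<gamma> s = gamma_curve H c1 c2 c3 s)))
     \<and>
     (\<forall>c1 c2 c3. (c1, c2) \<in> T_set I H \<longrightarrow>
        (let J = regular_params I H c1 c2; \<gamma> = gamma_curve H c1 c2 c3 in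
           J \<noteq> {} \<and> openin (top_of_set I) J \<and>
           C2_on J \<gamma> \<and> generates_C2_surface J \<gamma> \<and> has_mean_curvature_II J \<gamma> H \<and>
           ((c1, c2) \<in> (\<Inter>s\<in>I. {(X, Y). (X - F_int H s)\<^sup>2 + (Y + G_int H s)\<^sup>2 \<noteq> 0}) \<longrightarrow> J = I)))"
proof (intro conjI allI impI, goal_cases)
  case (1 \<gamma>)
  then show ?case using surface_gamma_curve[OF assms, of \<gamma>] by metis
next
  case (2 c1 c2 c3)
  \<comment> \<open>Membership in the union provides one regular parameter; membership in the
    intersection, treated next, makes every parameter regular.\<close>
  moreover have "regular_params I H c1 c2 \<noteq> {}" if "(c1, c2) \<in> T_set I H"
    using that by (auto simp: T_set_def regular_params_def)
  moreover have "regular_params I H c1 c2 = I"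
    if "(c1, c2) \<in> (\<Inter>s\<in>I. {(X, Y). (X - F_int H s)\<^sup>2 + (Y + G_int H s)\<^sup>2 \<noteq> 0})"
    using that by (auto simp: regular_params_def)
  ultimately show ?case
    unfolding Let_def
    using openin_regular_params[OF assms] gamma_curve_surface[OF assms] by blast
qed

end
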